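(* Let $d \geq 1$, let $\Omega \subset \mathbb{R}^d$ be a bounded domain, let $\lambda > 0$, and let $G$ be the graph with vertex set $V = (\lambda \mathbb{Z}^d) \cap \Omega$ in which $u,v\in V$ are joined by an edge if and only if $\|u-v\|_2 = \lambda$. Assume $G$ is connected. Let $u \in \partial G$ be a vertex of degree $2d$ in $G$. Then there exists a vertex $v \in V$ such that at least one of the following holds: (1) $d(u,v) = d(w,v)$ for some neighbor $w$ of $u$; or (2) there is an index $i \in \{1,\dots,d\}$ such that the two antipodal neighbors $u + \lambda e_i$ and $u-\lambda e_i$ of $u$ satisfy $$ d(u + \lambda e_i , v) = d(u - \lambda e_i, v) = d(u, v) - 1.$$
   Context: $d(\cdot,\cdot)$ (with two arguments) is the graph distance in $G$ (number of edges in a shortest path), $\deg(u)$ is the number of neighbors of $u$ in $G$, $\lambda\mathbb{Z}^d=\{\lambda z: z\in\mathbb{Z}^d\}$, and $e_i$ is the $i$-th standard basis vector of $\mathbb{R}^d$. The boundary of a graph $G=(V,E)$ is $$\partial G = \left\{u \in V : \exists\, v \in V \text{ such that } \frac{1}{\deg(u)} \sum_{w:\,(u, w) \in E} d(w,v) < d(u,v) \right\}.$$ *)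

theory Defs
  imports "HOL-Analysis.Analysis" "Graph_Theory.Graph_Theory"
begin

text \<open>Undirected graphs are symmetric digraphs: an edge is a pair of opposite arcs.\<close>

definition neighbors :: "('a, 'b) pre_digraph \<Rightarrow> 'a \<Rightarrow> 'a set" where
  "neighbors G u = {w. u \<rightarrow>\<^bsub>G\<^esub> w}"

definition deg :: "('a, 'b) pre_digraph \<Rightarrow> 'a \<Rightarrow> nat" where
  "deg G u = card (neighbors G u)"

text \<open>Meaningful only if some path from \<open>u\<close> to \<open>v\<close> exists, in particular
  for all vertices of a connected graph; otherwise the value is unspecified.\<close>

definition gdist :: "('a, 'b) pre_digraph \<Rightarrow> 'a \<Rightarrow> 'a \<Rightarrow> nat" where
  "gdist G u v = (LEAST n. \<exists>p. pre_digraph.apath G u p v \<and> length p = n)"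

lemma (in fin_digraph) mu_eq_gdist:
  assumes "u \<rightarrow>\<^sup>* v"
  shows "\<mu> (\<lambda>_. 1) u v = ereal (real (gdist G u v))"
proof -
  have cost: "awalk_cost (\<lambda>_. 1) p = real (length p)" for p
    by (induction p) auto
  obtain p where p: "apath u p v" "\<mu> (\<lambda>_. 1) u v = awalk_cost (\<lambda>_. 1) p"
    using min_cost_awalk[OF assms, of "\<lambda>_. 1"] by auto
  have "length p \<le> length q" if "apath u q v" for q
    using min_cost_le_walk_cost[of u q v "\<lambda>_. 1"] that p(2) cost
    by (auto simp: apath_def)
  then have "gdist G u v = length p"
    unfolding gdist_def using p(1) by (intro Least_equality) auto
  with p(2) cost show ?thesis by simp
qed

definition graph_boundary :: "('a, 'b) pre_digraph \<Rightarrow> 'a set" where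
  "graph_boundary G = {u \<in> verts G. \<exists>v \<in> verts G.
     1 / real (deg G u) * (\<Sum>w\<in>neighbors G u. real (gdist G w v)) < real (gdist G u v)}"

definition scaled_lattice :: "real \<Rightarrow> (real ^ 'n) set" where
  "scaled_lattice l = (\<lambda>z. l *\<^sub>R z) ` {z. \<forall>i. z $ i \<in> \<int>}"

definition lattice_graph :: "real \<Rightarrow> (real ^ 'n) set \<Rightarrow> (real ^ 'n) pair_pre_digraph" where
  "lattice_graph l \<Omega> = \<lparr> pverts = scaled_lattice l \<inter> \<Omega>,
     parcs = {(u, v). u \<in> scaled_lattice l \<inter> \<Omega> \<and> v \<in> scaled_lattice l \<inter> \<Omega> \<and> norm (u - v) = l} \<rparr>"

end

theory Submission
  imports Defs
begin

text \<open>A vertex of full degree has exactly the \<open>d\<close> antipodal pairs \<open>u \<plusminus> l e\<^sub>i\<close> as neighbors, so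
  the averaging inequality of the boundary yields one pair whose distances to \<open>v\<close> sum to less than
  twice the distance from \<open>u\<close>. If no neighbor is equidistant, each distance in this pair is off by
  exactly one, hence both are smaller by one.\<close>

text \<open>Every step of \<open>awalk_to_apath\<close> cuts a closed subwalk out of the walk, which
  cannot lengthen it.\<close>

lemma (in wf_digraph) length_awalk_to_apath_le:
  assumes "awalk u p v"
  shows "length (awalk_to_apath p) \<le> length p"
  using assms
proof (induct rule: awalk_to_apath_induct)
  case (path p)
  then have "awalk_to_apath p = p"
    by (auto simp: awalk_to_apath.simps)
  then show ?case by simp
next
  case (decomp p q r s)
  then have "length (q @ s) \<le> length p"
    by (auto elim!: awalk_cyc_decompE)
  with decomp show ?case using step_awalk_to_apath[of _ p _ q r s] by simp
qed

text \<open>\<open>gdist\<close> minimizes over paths only. Removing loops lets any walk bound it,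
  so later constructions need not avoid repeated vertices.\<close>

lemma (in wf_digraph) gdist_le_length_awalk:
  assumes "awalk u p v"
  shows "gdist G u v \<le> length p"
proof -
  have "gdist G u v \<le> length (awalk_to_apath p)"
    unfolding gdist_def using apath_awalk_to_apath[OF assms] by (intro Least_le) blast
  also note length_awalk_to_apath_le[OF assms]
  finally show ?thesis .
qed

lemma (in wf_digraph) gdist_witness:
  assumes "u \<rightarrow>\<^sup>* v"
  obtains p where "awalk u p v" "length p = gdist G u v"
proof -
  have "\<exists>n p. apath u p v \<and> length p = n"
    using assms by (simp add: reachable_apath)
  then have "\<exists>p. apath u p v \<and> length p = gdist G u v"
    unfolding gdist_def by (rule LeastI_ex)
  then show thesis using that by (auto simp: apath_def)
qed

text \<open>Prepend the arc to a shortest walk from \<open>w\<close>. The result may pass through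
  \<open>u\<close> again, which is why the bound for walks is used.\<close>

lemma (in wf_digraph) gdist_le_Suc:
  assumes "u \<rightarrow> w" "w \<rightarrow>\<^sup>* v"
  shows "gdist G u v \<le> Suc (gdist G w v)"
proof -
  obtain p where p: "awalk w p v" "length p = gdist G w v"
    using gdist_witness[OF assms(2)] .
  obtain e where "e \<in> arcs G" "tail G e = u" "head G e = w"
    using assms(1) by (rule reachableE)
  with p(1) have "awalk u (e # p) v"
    by (auto simp: awalk_Cons_iff)
  from gdist_le_length_awalk[OF this] p(2) show ?thesis by simp
qed

lemma sym_digraph_lattice_graph: "sym_digraph (with_proj (lattice_graph l \<Omega>))"
  by unfold_locales
    (auto simp: lattice_graph_def symmetric_def sym_def norm_minus_commute)

text \<open>The squared coordinates sum to 1, and a nonzero integer coordinate already contributes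
  at least 1, so it leaves nothing for the others.\<close>

lemma Ints_vec_norm_1_imp_axis:
  fixes z :: "real ^ 'n"
  assumes "\<And>i. z $ i \<in> \<int>" "norm z = 1"
  obtains i where "z = axis i 1 \<or> z = - axis i 1"
proof -
  have sum1: "(\<Sum>i\<in>UNIV. (z $ i)\<^sup>2) = 1"
    using assms(2) by (simp add: norm_vec_def L2_set_def)
  have "z \<noteq> 0" using assms(2) by auto
  then obtain i where i: "z $ i \<noteq> 0" by (auto simp: vec_eq_iff)
  have ge1: "(z $ i)\<^sup>2 \<ge> 1"
    using Ints_nonzero_abs_ge1[OF assms(1) i] by (simp add: abs_le_square_iff[of 1, simplified])
  have split: "(z $ i)\<^sup>2 + (\<Sum>j\<in>UNIV - {i}. (z $ j)\<^sup>2) = 1"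
    using sum1 by (simp add: sum.remove[of UNIV i])
  moreover have nn: "(\<Sum>j\<in>UNIV - {i}. (z $ j)\<^sup>2) \<ge> 0" by (simp add: sum_nonneg)
  ultimately have "(z $ i)\<^sup>2 = 1" "(\<Sum>j\<in>UNIV - {i}. (z $ j)\<^sup>2) = 0"
    using ge1 by linarith+
  then have "z $ i = 1 \<or> z $ i = -1" "\<forall>j. j \<noteq> i \<longrightarrow> z $ j = 0"
    by (auto simp: power2_eq_1_iff sum_nonneg_eq_0_iff)
  then have "z = axis i 1 \<or> z = - axis i 1"
    by (auto simp: vec_eq_iff axis_def)
  then show thesis by (rule that)
qed

text \<open>Dividing the difference of two adjacent vertices by \<open>l\<close> gives an integer
  vector of norm 1. In general only an inclusion holds, since some of these points may lie outside
  \<open>\<Omega>\<close>.\<close>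

lemma neighbors_lattice_graph_subset:
  fixes \<Omega> :: "(real ^ 'n) set"
  assumes "l > 0"
  shows "neighbors (with_proj (lattice_graph l \<Omega>)) u
    \<subseteq> range (\<lambda>i. u + l *\<^sub>R axis i 1) \<union> range (\<lambda>i. u - l *\<^sub>R axis i 1)"
proof
  fix w assume "w \<in> neighbors (with_proj (lattice_graph l \<Omega>)) u"
  then have "u \<in> scaled_lattice l" "w \<in> scaled_lattice l" and n: "norm (u - w) = l"
    by (auto simp: neighbors_def lattice_graph_def)
  then obtain a b where a: "u = l *\<^sub>R a" "\<forall>i. a $ i \<in> \<int>" and b: "w = l *\<^sub>R b" "\<forall>i. b $ i \<in> \<int>"
    by (auto simp: scaled_lattice_def)
  have eq: "w = u + l *\<^sub>R (b - a)" using a b by (simp add: scaleR_diff_right)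
  have "norm (b - a) = 1"
    using n assms unfolding eq by simp
  moreover have "(b - a) $ i \<in> \<int>" for i using a(2) b(2) by simp
  ultimately obtain i where "b - a = axis i 1 \<or> b - a = - axis i 1"
    using Ints_vec_norm_1_imp_axis by blast
  then show "w \<in> range (\<lambda>i. u + l *\<^sub>R axis i 1) \<union> range (\<lambda>i. u - l *\<^sub>R axis i 1)"
    unfolding eq by auto
qed

text \<open>Coordinate \<open>i\<close> of \<open>u + l *\<^sub>R axis i 1\<close> exceeds that of
  \<open>u\<close>, whereas subtracting a multiple \<open>l\<close> of an axis vector never
  increases a coordinate.\<close>

lemma axis_neighbors_disjoint:
  fixes u :: "real ^ 'n"
  assumes "l > 0"
  shows "range (\<lambda>i. u + l *\<^sub>R axis i 1) \<inter> range (\<lambda>i. u - l *\<^sub>R axis i 1) = {}"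
proof -
  have "u + l *\<^sub>R axis i 1 \<noteq> u - l *\<^sub>R axis j 1" for i j
  proof
    assume "u + l *\<^sub>R axis i 1 = u - l *\<^sub>R axis j 1"
    then have "(u + l *\<^sub>R axis i 1) $ i = (u - l *\<^sub>R axis j 1) $ i" by simp
    then show False using assms by (auto simp: axis_def split: if_splits)
  qed
  then show ?thesis by auto
qed

theorem proposition4:
  fixes \<Omega> :: "(real ^ 'n) set" and l :: real and u :: "real ^ 'n"
    and G :: "(real ^ 'n, (real ^ 'n) \<times> (real ^ 'n)) pre_digraph"
  assumes "open \<Omega>" and "Topological_Spaces.connected \<Omega>" and "\<Omega> \<noteq> {}" and "bounded \<Omega>"
    and "l > 0"
    and "G = with_proj (lattice_graph l \<Omega>)"
    and "Digraph_Component.connected G"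
    and "u \<in> graph_boundary G"
    and "deg G u = 2 * CARD('n)"
  shows "\<exists>v \<in> verts G.
    (\<exists>w \<in> neighbors G u. gdist G u v = gdist G w v) \<or>
    (\<exists>i. u + l *\<^sub>R axis i 1 \<in> neighbors G u \<and> u - l *\<^sub>R axis i 1 \<in> neighbors G u \<and>
         int (gdist G (u + l *\<^sub>R axis i 1) v) = int (gdist G u v) - 1 \<and>
         int (gdist G (u - l *\<^sub>R axis i 1) v) = int (gdist G u v) - 1)"
proof -
  interpret sym_digraph G
    unfolding assms(6) by (rule sym_digraph_lattice_graph)
  \<comment> \<open>The vertex \<open>v\<close> witnessing that \<open>u\<close> lies on the
    boundary serves in both alternatives.\<close>
  obtain v where u: "u \<in> verts G" and v: "v \<in> verts G" and
    avg: "1 / real (deg G u) * (\<Sum>w\<in>neighbors G u. real (gdist G w v)) < real (gdist G u v)"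
    using assms(8) by (auto simp: graph_boundary_def)
  define d where "d w = gdist G w v" for w
  define p where "p i = u + l *\<^sub>R axis i 1" for i :: 'n
  define m where "m i = u - l *\<^sub>R axis i 1" for i :: 'n
  have inj: "inj p" "inj m"
    using \<open>l > 0\<close> by (auto simp: inj_on_def p_def m_def axis_eq_axis)
  have disj: "range p \<inter> range m = {}"
    using axis_neighbors_disjoint[OF \<open>l > 0\<close>] unfolding p_def m_def .
  have "card (range p \<union> range m) = 2 * CARD('n)"
    using disj inj by (simp add: card_Un_disjoint card_image)
  moreover have "neighbors G u \<subseteq> range p \<union> range m"
    using neighbors_lattice_graph_subset[OF \<open>l > 0\<close>] unfolding assms(6) p_def m_def .
  \<comment> \<open>The degree hypothesis turns the inclusion into equality: both finite sets have
    \<open>2 * CARD('n)\<close> elements.\<close>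
  ultimately have nb: "neighbors G u = range p \<union> range m"
    using assms(9) by (intro card_subset_eq) (auto simp: deg_def)
  have step: "d w \<le> Suc (d u)" "d u \<le> Suc (d w)" if "w \<in> neighbors G u" for w
  proof -
    have uw: "u \<rightarrow>\<^bsub>G\<^esub> w" using that by (simp add: neighbors_def)
    then have wu: "w \<rightarrow>\<^bsub>G\<^esub> u" by (rule arcs_ends_symmetric[OF sym_arcs])
    have "w \<in> verts G" using uw by (rule adj_in_verts)
    then have "u \<rightarrow>\<^sup>*\<^bsub>G\<^esub> v" "w \<rightarrow>\<^sup>*\<^bsub>G\<^esub> v"
      using symmetric_connected_imp_strongly_connected[OF sym_arcs assms(7)] u v
      by (auto simp: strongly_connected_def)
    then show "d w \<le> Suc (d u)" "d u \<le> Suc (d w)"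
      unfolding d_def using gdist_le_Suc uw wu by blast+
  qed
  show ?thesis
  proof (cases "\<exists>w \<in> neighbors G u. d u = d w")
    case True
    then show ?thesis using v unfolding d_def by blast
  next
    case False
    have "(\<Sum>w\<in>neighbors G u. real (d w)) < 2 * real CARD('n) * real (d u)"
      using avg assms(9) by (simp add: d_def field_simps)
    also have "(\<Sum>w\<in>neighbors G u. real (d w)) = (\<Sum>i\<in>UNIV. real (d (p i)) + real (d (m i)))"
      using disj inj by (simp add: nb sum.union_disjoint sum.reindex sum.distrib)
    also have "2 * real CARD('n) * real (d u) = (\<Sum>i\<in>(UNIV :: 'n set). 2 * real (d u))"
      by simp
    \<comment> \<open>Otherwise every antipodal pair would contribute at least
      \<open>2 * real (d u)\<close>, and summing over \<open>i\<close> would contradict the strict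
      inequality.\<close>
    finally have "\<exists>i. real (d (p i)) + real (d (m i)) < 2 * real (d u)"
      by (meson sum_mono not_less)
    then obtain i where "real (d (p i)) + real (d (m i)) < 2 * real (d u)" ..
    then have i: "d (p i) + d (m i) < 2 * d u" by linarith
    have "p i \<in> neighbors G u" "m i \<in> neighbors G u" by (auto simp: nb)
    \<comment> \<open>Both distances are \<open>d u\<close> plus or minus 1. If one were larger, the
      other could at best compensate, making the sum at least \<open>2 * d u\<close>.\<close>
    moreover from this have "int (d (p i)) = int (d u) - 1" "int (d (m i)) = int (d u) - 1"
      using i step[of "p i"] step[of "m i"] False by fastforce+
    ultimately show ?thesis using v unfolding d_def p_def m_def by blast
  qed
qed

end
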